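(* Let $\mathbb{K}$ be a field of characteristic zero and let $n\ge 2$. Every $n$-Lie algebra over $\mathbb{K}$ is an sh-$n$-Lie algebra.
   Context: An $n$-ary algebra over $\mathbb{K}$ is a $\mathbb{K}$-vector space $A$ with an $n$-linear map $\mu:A^n\to A$. It is anticommutative (skewsymmetric) if $\mu(v_1,\dots,v_n)=0$ whenever $v_i=v_j$ for some $i\neq j$; equivalently, in characteristic zero, $\mu(v_{\sigma(1)},\dots,v_{\sigma(n)})=(-1)^{\epsilon(\sigma)}\mu(v_1,\dots,v_n)$ for every $\sigma$ in the symmetric group $\Sigma_n$, where $(-1)^{\epsilon(\sigma)}$ is the sign of $\sigma$. An $n$-Lie algebra (in the sense of Filippov) is an anticommutative $n$-ary algebra $(A,\mu)$ such that, writing $[v_1,\dots,v_n]=\mu(v_1,\dots,v_n)$, $$[[u_1,\dots,u_n],v_1,\dots,v_{n-1}]=\sum_{i=1}^n[u_1,\dots,u_{i-1},[u_i,v_1,\dots,v_{n-1}],u_{i+1},\dots,u_n]$$ for all $u_1,\dots,u_n,v_1,\dots,v_{n-1}\in A$. An sh-$n$-Lie algebra (also called a Lie $n$-algebra) is a vector space $A$ with a skewsymmetric $n$-ary product $\mu$ satisfying the (sh)-Jacobi identity $$\sum_{\sigma\in Sh(n,n-1)}(-1)^{\epsilon(\sigma)}\mu(\mu(x_{\sigma(1)},\dots,x_{\sigma(n)}),x_{\sigma(n+1)},\dots,x_{\sigma(2n-1)})=0$$ for all $x_1,\dots,x_{2n-1}\in A$, where $$Sh(n,n-1)=\{\sigma\in\Sigma_{2n-1}:\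 \sigma(1)<\cdots<\sigma(n),\ \sigma(n+1)<\cdots<\sigma(2n-1)\}.$$ *)

theory Defs
  imports Complex_Main "HOL-Combinatorics.Permutations"
begin

text \<open>
  An n-ary product is a function on lists, of which only the values on lists of length
  \<open>n\<close> are relevant. List positions count from 0, so the argument \<open>v\<^sub>i\<close> is \<open>vs ! (i - 1)\<close>.
\<close>

locale nary_algebra = vector_space scale
  for scale :: "'k::field \<Rightarrow> 'v::ab_group_add \<Rightarrow> 'v" +
  fixes n :: nat
    and \<mu> :: "'v list \<Rightarrow> 'v"
  assumes multilinear:
    "\<And>vs i. length vs = n \<Longrightarrow> i < n \<Longrightarrow> Vector_Spaces.linear scale scale (\<lambda>v. \<mu> (vs[i := v]))"

locale anticommutative_nary_algebra = nary_algebra +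
  assumes anticommutative:
    "\<And>vs i j. length vs = n \<Longrightarrow> i < n \<Longrightarrow> j < n \<Longrightarrow> i \<noteq> j \<Longrightarrow> vs ! i = vs ! j \<Longrightarrow> \<mu> vs = 0"

locale n_Lie_algebra = anticommutative_nary_algebra +
  assumes filippov_identity:
    "\<And>us vs. length us = n \<Longrightarrow> length vs = n - 1 \<Longrightarrow>
       \<mu> (\<mu> us # vs) = (\<Sum>i<n. \<mu> (us[i := \<mu> (us ! i # vs)]))"

definition shuffle_perms :: "nat \<Rightarrow> nat \<Rightarrow> (nat \<Rightarrow> nat) set" where
  "shuffle_perms p q =
     {\<sigma>. \<sigma> permutes {1..p + q} \<and> strict_mono_on {1..p} \<sigma> \<and> strict_mono_on {p + 1..p + q} \<sigma>}"

text \<open>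
  The elements \<open>x\<^sub>1, \<dots>, x\<^bsub>2n-1\<^esub>\<close> are given as a function on \<open>nat\<close>, of which only the values
  on \<open>{1..2 * n - 1}\<close> occur.
\<close>

locale sh_n_Lie_algebra = anticommutative_nary_algebra scale n \<mu>
  for scale :: "'k::field \<Rightarrow> 'v::ab_group_add \<Rightarrow> 'v"
    and n :: nat
    and \<mu> :: "'v list \<Rightarrow> 'v" +
  assumes sh_Jacobi_identity:
    "\<And>x :: nat \<Rightarrow> 'v.
       (\<Sum>\<sigma> \<in> shuffle_perms n (n - 1).
          scale (of_int (sign \<sigma>))
            (\<mu> (\<mu> (map (\<lambda>i. x (\<sigma> i)) [1..<n + 1]) # map (\<lambda>i. x (\<sigma> i)) [n + 1..<2 * n]))) = 0"

end

theory Submission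
  imports Defs "HOL-Library.Infinite_Set"
begin

text \<open>
  Let \<open>J\<close> be the signed sum of \<open>[[x\<^bsub>\<sigma> 1\<^esub>, \<dots>, x\<^bsub>\<sigma> n\<^esub>], x\<^bsub>\<sigma> (n+1)\<^esub>, \<dots>, x\<^bsub>\<sigma> (2n-1)\<^esub>]\<close> over all
  permutations \<open>\<sigma>\<close> of \<open>{1..2n-1}\<close>, not only over the shuffles. Anticommutativity makes a signed
  summand insensitive to permuting the first \<open>n\<close> or the last \<open>n - 1\<close> positions, and every
  permutation is uniquely a shuffle followed by such a pair of block permutations. Hence \<open>J\<close> is
  \<open>n! (n-1)!\<close> times the sum in the sh-Jacobi identity
  (\<open>antisymmetrised_double_bracket_eq_shuffle_sum\<close>), and in characteristic zero it suffices to
  show \<open>J = 0\<close>.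

  The full sum may be reindexed freely. Expand each summand by the Filippov identity into
  \<open>n\<close> terms \<open>[u\<^sub>1, \<dots>, [u\<^sub>i, v\<^sub>1, \<dots>, v\<^bsub>n-1\<^esub>], \<dots>, u\<^sub>n]\<close>. Reindexing by the transposition of the positions
  \<open>1\<close> and \<open>i\<close> shows that all \<open>n\<close> of them contribute equally to the antisymmetrised sum; and the
  contribution for \<open>i = 1\<close>, the sum over \<open>[[u\<^sub>1, v\<^sub>1, \<dots>, v\<^bsub>n-1\<^esub>], u\<^sub>2, \<dots>, u\<^sub>n]\<close>, is \<open>\<plusminus> J\<close>, by
  reindexing with the exchange of the blocks \<open>u\<^sub>2, \<dots>, u\<^sub>n\<close> and \<open>v\<^sub>1, \<dots>, v\<^bsub>n-1\<^esub>\<close>. So \<open>J = \<plusminus> n J\<close>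
  (\<open>antisymmetrised_double_bracket_eigenvector\<close>), and \<open>\<plusminus> n \<noteq> 1\<close> because \<open>n \<ge> 2\<close>.
\<close>

section \<open>Unshuffling permutations\<close>

text \<open>
  At the least point \<open>x\<close> that moves, \<open>f x\<close> cannot be smaller, since the smaller values are already
  taken; so it is larger, and then the preimage of \<open>x\<close> lies above \<open>x\<close> and breaks monotonicity.
\<close>

lemma strict_mono_on_bij_betw_fixes:
  fixes A :: "'a::wellorder set"
  assumes bij: "bij_betw f A A" and mono: "strict_mono_on A f" and "x \<in> A"
  shows "f x = x"
  using \<open>x \<in> A\<close>
proof (induction x rule: less_induct)
  case (less x)
  have fx: "f x \<in> A" using bij less.prems by (auto simp: bij_betw_def)
  obtain z where z: "z \<in> A" "f z = x" using bij less.prems by (metis bij_betw_def imageE)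
  show ?case
  proof (rule linorder_cases[of "f x" x])
    assume lt: "f x < x"
    then have "f (f x) = f x" using less.IH fx by blast
    then show ?thesis using bij fx less.prems by (auto simp: bij_betw_def inj_on_def)
  next
    assume gt: "x < f x"
    have "\<not> z < x" using less.IH z by (metis less_irrefl)
    moreover have "\<not> x < z" using strict_mono_onD[OF mono less.prems z(1)] z gt by auto
    ultimately show ?thesis using z by auto
  qed
qed

text \<open>
  The monotone function is determined because \<open>\<alpha>' \<circ> inv \<alpha>\<close> is a strictly monotone permutation of
  \<open>A\<close>. Applied to each block in turn, this makes the factorisation of a permutation through a
  shuffle unique.
\<close>

lemma strict_mono_on_rearrangement_unique:
  fixes A :: "'a::wellorder set" and r r' :: "'a \<Rightarrow> 'b::linorder"
  assumes mono: "strict_mono_on A r" "strict_mono_on A r'"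
    and perm: "\<alpha> permutes A" "\<alpha>' permutes A"
    and eq: "\<And>x. x \<in> A \<Longrightarrow> r (\<alpha> x) = r' (\<alpha>' x)"
  shows "\<alpha> = \<alpha>'" and "\<And>x. x \<in> A \<Longrightarrow> r x = r' x"
proof -
  define \<theta> where "\<theta> = \<alpha>' \<circ> inv \<alpha>"
  have \<theta>: "\<theta> permutes A" unfolding \<theta>_def using perm by (intro permutes_compose permutes_inv)
  have r: "r y = r' (\<theta> y)" if "y \<in> A" for y
    using eq[of "inv \<alpha> y"] that perm(1)
    by (simp add: \<theta>_def permutes_inverses permutes_in_image[OF permutes_inv])
  have "strict_mono_on A \<theta>"
  proof (rule strict_mono_onI)
    fix x y assume xy: "x \<in> A" "y \<in> A" "x < y"
    then have lt: "r' (\<theta> x) < r' (\<theta> y)" using strict_mono_onD[OF mono(1)] r by metis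
    have "\<theta> x \<in> A" "\<theta> y \<in> A" using \<theta> xy by (simp_all add: permutes_in_image)
    then show "\<theta> x < \<theta> y"
      using lt strict_mono_onD[OF mono(2), of "\<theta> y" "\<theta> x"] by (metis linorder_cases less_asym less_irrefl)
  qed
  then have fix_A: "\<theta> x = x" if "x \<in> A" for x
    using strict_mono_on_bij_betw_fixes[OF permutes_imp_bij[OF \<theta>]] that by blast
  then show "\<And>x. x \<in> A \<Longrightarrow> r x = r' x" using r by simp
  have "\<theta> = id" using fix_A \<theta> by (auto simp: permutes_def fun_eq_iff)
  then have "\<theta> \<circ> \<alpha> = \<alpha>" by simp
  then show "\<alpha> = \<alpha>'" using perm(1) by (simp add: \<theta>_def o_assoc[symmetric] permutes_inv_o)
qed

text \<open>
  Matching the increasing enumerations \<open>h\<close> of \<open>A\<close> and \<open>g\<close> of \<open>s ` A\<close> says where the sorted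
  function has to send each point; \<open>\<tau>\<close> is that matching pulled back along \<open>s\<close>.
\<close>

lemma ex_strict_mono_on_rearrangement:
  fixes A :: "nat set" and s :: "nat \<Rightarrow> nat"
  assumes "finite A" and inj: "inj_on s A"
  shows "\<exists>\<tau>. \<tau> permutes A \<and> strict_mono_on A (s \<circ> \<tau>)"
proof -
  obtain h where h: "bij_betw h {..<card A} A" "strict_mono_on {..<card A} h"
    using ex_bij_betw_strict_mono_card[OF \<open>finite A\<close>] .
  obtain g where g: "bij_betw g {..<card A} (s ` A)" "strict_mono_on {..<card A} g"
    using ex_bij_betw_strict_mono_card[of "s ` A"] card_image[OF inj] \<open>finite A\<close> by (metis finite_imageI)
  define k where "k = inv_into {..<card A} h"
  have k: "bij_betw k A {..<card A}" unfolding k_def by (rule bij_betw_inv_into[OF h(1)])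
  have hk: "h (k x) = x" if "x \<in> A" for x
    using that h(1) by (simp add: k_def bij_betw_inv_into_right)
  have k_mono: "strict_mono_on A k"
  proof (rule strict_mono_onI)
    fix x y assume xy: "x \<in> A" "y \<in> A" "x < y"
    then have "k x \<in> {..<card A}" "k y \<in> {..<card A}" using k by (auto simp: bij_betw_def)
    then show "k x < k y"
      using hk xy strict_mono_onD[OF h(2), of "k y" "k x"] by (metis linorder_cases less_asym less_irrefl)
  qed
  define t where "t = (\<lambda>x. if x \<in> A then inv_into A s (g (k x)) else x)"
  have "bij_betw (inv_into A s \<circ> (g \<circ> k)) A A"
    by (intro bij_betw_trans[OF bij_betw_trans[OF k g(1)]] bij_betw_inv_into inj_on_imp_bij_betw inj)
  then have "bij_betw t A A" by (rule bij_betw_cong[THEN iffD1, rotated]) (simp add: t_def)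
  then have "t permutes A" by (rule bij_imp_permutes) (simp add: t_def)
  moreover have st: "s (t x) = g (k x)" if "x \<in> A" for x
  proof -
    have "g (k x) \<in> s ` A" using that k g(1) by (auto simp: bij_betw_def)
    then show ?thesis using that by (simp add: t_def f_inv_into_f)
  qed
  have "strict_mono_on A (s \<circ> t)"
  proof (rule strict_mono_onI)
    fix x y assume xy: "x \<in> A" "y \<in> A" "x < y"
    then have "k x \<in> {..<card A}" "k y \<in> {..<card A}" using k by (auto simp: bij_betw_def)
    then have "g (k x) < g (k y)"
      using strict_mono_onD[OF g(2)] strict_mono_onD[OF k_mono] xy by blast
    then show "(s \<circ> t) x < (s \<circ> t) y" using st xy by simp
  qed
  ultimately show ?thesis by blast
qed

text \<open>
  The shuffles are coset representatives of the Young subgroup of permutations preserving both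
  blocks: sort the values of a permutation on each block separately.
\<close>

lemma bij_betw_shuffle_perms_times_block_permutations:
  "bij_betw (\<lambda>(\<rho>, \<alpha>, \<beta>). \<rho> \<circ> \<alpha> \<circ> \<beta>)
     (shuffle_perms p q \<times> {\<alpha>. \<alpha> permutes {1..p}} \<times> {\<beta>. \<beta> permutes {p + 1..p + q}})
     {\<sigma>. \<sigma> permutes {1..p + q}}"
  (is "bij_betw ?f (?S \<times> ?P \<times> ?Q) ?R")
proof -
  let ?A = "{1..p}" and ?B = "{p + 1..p + q}" and ?C = "{1..p + q}"
  have on_A: "\<beta> x = x" if "\<beta> permutes ?B" "x \<in> ?A" for \<beta> x
    using that by (auto intro: permutes_not_in)
  have on_B: "\<alpha> x = x" if "\<alpha> permutes ?A" "x \<in> ?B" for \<alpha> x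
    using that by (auto intro: permutes_not_in)
  have sub: "\<alpha> permutes ?C" if "\<alpha> permutes ?A \<or> \<alpha> permutes ?B" for \<alpha>
    using that by (elim disjE permutes_subset) auto
  have "inj_on ?f (?S \<times> ?P \<times> ?Q)"
  proof (rule inj_onI, clarify, simp only: prod.case prod.inject)
    fix \<rho> \<alpha> \<beta> \<rho>' \<alpha>' \<beta>'
    assume S: "\<rho> \<in> ?S" "\<rho>' \<in> ?S"
      and P: "\<alpha> permutes ?A" "\<alpha>' permutes ?A" and Q: "\<beta> permutes ?B" "\<beta>' permutes ?B"
      and eq: "\<rho> \<circ> \<alpha> \<circ> \<beta> = \<rho>' \<circ> \<alpha>' \<circ> \<beta>'"
    have eq': "\<rho> (\<alpha> (\<beta> x)) = \<rho>' (\<alpha>' (\<beta>' x))" for x using fun_cong[OF eq, of x] by simp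
    have mono: "strict_mono_on ?A \<rho>" "strict_mono_on ?A \<rho>'" "strict_mono_on ?B \<rho>" "strict_mono_on ?B \<rho>'"
      and perm: "\<rho> permutes ?C" "\<rho>' permutes ?C"
      using S by (auto simp: shuffle_perms_def)
    have eqA: "\<rho> (\<alpha> x) = \<rho>' (\<alpha>' x)" if "x \<in> ?A" for x
      using eq'[of x] on_A[OF Q(1) that] on_A[OF Q(2) that] by simp
    have eqB: "\<rho> (\<beta> x) = \<rho>' (\<beta>' x)" if "x \<in> ?B" for x
    proof -
      have "\<beta> x \<in> ?B" "\<beta>' x \<in> ?B" using Q that permutes_in_image by metis+
      then show ?thesis using eq'[of x] on_B[OF P(1)] on_B[OF P(2)] by metis
    qed
    note A = strict_mono_on_rearrangement_unique[OF mono(1,2) P eqA]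
    note B = strict_mono_on_rearrangement_unique[OF mono(3,4) Q eqB]
    have "\<rho> x = \<rho>' x" for x
    proof (cases "x \<in> ?C")
      case True
      then have "x \<in> ?A \<or> x \<in> ?B" by auto
      then show ?thesis using A(2) B(2) by blast
    next
      case False
      then show ?thesis using permutes_not_in[OF perm(1)] permutes_not_in[OF perm(2)] by simp
    qed
    then show "\<rho> = \<rho>' \<and> \<alpha> = \<alpha>' \<and> \<beta> = \<beta>'" using A(1) B(1) by blast
  qed
  moreover have "?f ` (?S \<times> ?P \<times> ?Q) \<subseteq> ?R"
  proof clarify
    fix \<rho> \<alpha> \<beta> assume "\<rho> \<in> ?S" "\<alpha> permutes ?A" "\<beta> permutes ?B"
    then have "\<rho> permutes ?C" "\<alpha> permutes ?C" "\<beta> permutes ?C"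
      using sub by (simp add: shuffle_perms_def, blast, blast)
    then show "\<rho> \<circ> \<alpha> \<circ> \<beta> permutes ?C" by (intro permutes_compose)
  qed
  moreover have "\<sigma> \<in> ?f ` (?S \<times> ?P \<times> ?Q)" if \<sigma>: "\<sigma> permutes ?C" for \<sigma>
  proof -
    have inj: "inj_on \<sigma> X" for X using permutes_inj_on[OF \<sigma>] .
    obtain \<alpha> where \<alpha>: "\<alpha> permutes ?A" "strict_mono_on ?A (\<sigma> \<circ> \<alpha>)"
      using ex_strict_mono_on_rearrangement[OF _ inj] by blast
    obtain \<beta> where \<beta>: "\<beta> permutes ?B" "strict_mono_on ?B (\<sigma> \<circ> \<beta>)"
      using ex_strict_mono_on_rearrangement[OF _ inj] by blast
    define \<rho> where "\<rho> = \<sigma> \<circ> \<beta> \<circ> \<alpha>"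
    have "\<alpha> permutes ?C" "\<beta> permutes ?C" using sub \<alpha>(1) \<beta>(1) by blast+
    then have "\<rho> permutes ?C" unfolding \<rho>_def using \<sigma> by (intro permutes_compose)
    moreover have "strict_mono_on ?A \<rho>"
    proof -
      have "\<rho> x = (\<sigma> \<circ> \<alpha>) x" if "x \<in> ?A" for x
      proof -
        have "\<alpha> x \<in> ?A" using \<alpha>(1) that permutes_in_image by metis
        then show ?thesis using on_A[OF \<beta>(1)] by (simp only: \<rho>_def comp_apply)
      qed
      then show ?thesis using \<alpha>(2) unfolding strict_mono_on_def by metis
    qed
    moreover have "strict_mono_on ?B \<rho>"
    proof -
      have "\<rho> x = (\<sigma> \<circ> \<beta>) x" if "x \<in> ?B" for x
        using on_B[OF \<alpha>(1) that] by (simp add: \<rho>_def)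
      then show ?thesis using \<beta>(2) unfolding strict_mono_on_def by metis
    qed
    ultimately have "\<rho> \<in> ?S" by (simp add: shuffle_perms_def)
    moreover have "\<sigma> = \<rho> \<circ> inv \<alpha> \<circ> inv \<beta>"
      by (simp add: \<rho>_def fun_eq_iff permutes_inverses[OF \<alpha>(1)] permutes_inverses[OF \<beta>(1)])
    ultimately show ?thesis
      using permutes_inv[OF \<alpha>(1)] permutes_inv[OF \<beta>(1)]
      by (intro image_eqI[of _ _ "(\<rho>, inv \<alpha>, inv \<beta>)"]) auto
  qed
  ultimately show ?thesis unfolding bij_betw_def by blast
qed

lemma (in module) sum_const_eq_scale: "(\<Sum>t\<in>T. v) = scale (of_nat (card T)) v"
  by (induction T rule: infinite_finite_induct) (auto simp: scale_left_distrib)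

lemma (in module) sum_permutations_eq_shuffle_sum:
  assumes A: "\<And>\<sigma> \<alpha>. \<sigma> permutes {1..p + q} \<Longrightarrow> \<alpha> permutes {1..p} \<Longrightarrow> f (\<sigma> \<circ> \<alpha>) = f \<sigma>"
    and B: "\<And>\<sigma> \<beta>. \<sigma> permutes {1..p + q} \<Longrightarrow> \<beta> permutes {p + 1..p + q} \<Longrightarrow> f (\<sigma> \<circ> \<beta>) = f \<sigma>"
  shows "(\<Sum>\<sigma> | \<sigma> permutes {1..p + q}. f \<sigma>)
           = scale (of_nat (fact p * fact q)) (\<Sum>\<sigma> \<in> shuffle_perms p q. f \<sigma>)"
proof -
  let ?P = "{\<alpha>. \<alpha> permutes {1..p}}" and ?Q = "{\<beta>. \<beta> permutes {p + 1..p + q}}"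
  have card: "card (?P \<times> ?Q) = fact p * fact q"
    by (simp add: card_cartesian_product card_permutations)
  have "(\<Sum>\<sigma> | \<sigma> permutes {1..p + q}. f \<sigma>)
      = (\<Sum>(\<rho>, \<alpha>, \<beta>) \<in> shuffle_perms p q \<times> ?P \<times> ?Q. f (\<rho> \<circ> \<alpha> \<circ> \<beta>))"
    using sum.reindex_bij_betw[OF bij_betw_shuffle_perms_times_block_permutations[of p q], of f]
    by (simp add: case_prod_unfold)
  also have "\<dots> = (\<Sum>(\<rho>, \<alpha>, \<beta>) \<in> shuffle_perms p q \<times> ?P \<times> ?Q. f \<rho>)"
  proof (rule sum.cong[OF refl], clarify)
    fix \<rho> \<alpha> \<beta>
    assume "\<rho> \<in> shuffle_perms p q" and \<alpha>: "\<alpha> permutes {1..p}" and \<beta>: "\<beta> permutes {p + 1..p + q}"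
    then have \<rho>: "\<rho> permutes {1..p + q}" by (simp add: shuffle_perms_def)
    have "\<rho> \<circ> \<alpha> permutes {1..p + q}"
      using \<rho> \<alpha> by (intro permutes_compose) (auto elim: permutes_subset)
    then show "f (\<rho> \<circ> \<alpha> \<circ> \<beta>) = f \<rho>" using A[OF \<rho> \<alpha>] B[OF _ \<beta>] by simp
  qed
  also have "\<dots> = (\<Sum>\<rho> \<in> shuffle_perms p q. \<Sum>t \<in> ?P \<times> ?Q. f \<rho>)"
    by (simp add: sum.cartesian_product case_prod_unfold)
  also have "\<dots> = scale (of_nat (fact p * fact q)) (\<Sum>\<rho> \<in> shuffle_perms p q. f \<rho>)"
    by (simp only: sum_const_eq_scale card scale_sum_right)
  finally show ?thesis .
qed

section \<open>Antisymmetrised double brackets\<close>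

text \<open>
  Restricting \<open>\<sigma>\<close> to permutations of finite support allows \<open>f\<close> to contain the factor \<open>sign \<sigma>\<close>,
  which is multiplicative only there.
\<close>

lemma invariant_under_permutes_if_invariant_under_transpose:
  assumes inv: "\<And>\<sigma> i j. permutation \<sigma> \<Longrightarrow> i \<in> A \<Longrightarrow> j \<in> A \<Longrightarrow> i \<noteq> j \<Longrightarrow> f (\<sigma> \<circ> transpose i j) = f \<sigma>"
    and "finite A" "\<tau> permutes A" "permutation \<sigma>"
  shows "f (\<sigma> \<circ> \<tau>) = f \<sigma>"
  using \<open>finite A\<close> \<open>\<tau> permutes A\<close>
proof (induction \<tau> rule: permutes_rev_induct)
  case id
  show ?case by simp
next
  case (swap a b p)
  have "permutation (\<sigma> \<circ> p)"
    using permutation_compose[OF \<open>permutation \<sigma>\<close>] permutes_imp_permutation[OF \<open>finite A\<close>] swap by blast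
  then have "f ((\<sigma> \<circ> p) \<circ> transpose a b) = f (\<sigma> \<circ> p)"
    using inv[of "\<sigma> \<circ> p" a b] swap.hyps by (cases "a = b") auto
  moreover have "f (\<sigma> \<circ> p) = f \<sigma>" by (fact swap.IH)
  ultimately show ?case by (simp add: comp_def)
qed

context anticommutative_nary_algebra
begin

text \<open>
  Polarisation: put the sum of the two arguments into both positions and expand.
\<close>

lemma swap_arguments:
  assumes len: "length ws = n" and ij: "i < n" "j < n" "i \<noteq> j"
  shows "\<mu> (ws[i := ws ! j, j := ws ! i]) = - \<mu> ws"
proof -
  let ?a = "ws ! i" and ?b = "ws ! j"
  define m where "m = (\<lambda>u v. \<mu> (ws[i := u, j := v]))"
  have addr: "m u (v + v') = m u v + m u v'" for u v v'
    unfolding m_def using multilinear[of "ws[i := u]" j] len ij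
    by (simp add: linear_iff_module_hom module_hom_iff)
  have addl: "m (u + u') v = m u v + m u' v" for u u' v
    unfolding m_def list_update_swap[OF ij(3)] using multilinear[of "ws[j := v]" i] len ij
    by (simp add: linear_iff_module_hom module_hom_iff)
  have zero: "m u u = 0" for u
    unfolding m_def using anticommutative[of "ws[i := u, j := u]" i j] len ij by simp
  have "0 = m (?a + ?b) (?a + ?b)" by (simp only: zero)
  also have "\<dots> = (m ?a ?a + m ?b ?a) + (m ?a ?b + m ?b ?b)" by (simp only: addl addr)
  also have "\<dots> = m ?a ?b + m ?b ?a" by (simp add: zero)
  finally have "m ?b ?a = - m ?a ?b" by (metis add_eq_0_iff)
  then show ?thesis by (simp add: m_def)
qed

lemma swap_arguments_transpose:
  assumes ij: "i < n" "j < n" "i \<noteq> j"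
    and ws: "length ws = n" and ws': "length ws' = n" "\<And>k. k < n \<Longrightarrow> ws' ! k = ws ! transpose i j k"
  shows "\<mu> ws' = - \<mu> ws"
proof -
  have "ws' = ws[i := ws ! j, j := ws ! i]"
    using assms by (intro nth_equalityI) (auto simp: nth_list_update transpose_def)
  then show ?thesis using swap_arguments[OF ws ij] by simp
qed

text \<open>
  Only the values of \<open>y\<close> on \<open>{1..2n-1}\<close> occur. Taking the family \<open>y\<close> as the argument turns a
  permutation of the positions into precomposition, so that \<open>\<sigma>\<close> acts on the arguments \<open>x\<close> as
  \<open>x \<circ> \<sigma>\<close>.
\<close>

definition double_bracket :: "(nat \<Rightarrow> 'b) \<Rightarrow> 'b" where
  "double_bracket y = \<mu> (\<mu> (map y [1..<n + 1]) # map y [n + 1..<2 * n])"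

lemma double_bracket_transpose_inner:
  assumes "i \<in> {1..n}" "j \<in> {1..n}" "i \<noteq> j"
  shows "double_bracket (y \<circ> transpose i j) = - double_bracket y"
proof -
  have n: "n > 0" using assms by auto
  let ?vs = "map y [n + 1..<2 * n]"
  have vs: "map (y \<circ> transpose i j) [n + 1..<2 * n] = ?vs"
    using assms by (auto simp: transpose_def)
  have "\<mu> (map (y \<circ> transpose i j) [1..<n + 1]) = - \<mu> (map y [1..<n + 1])"
    using assms by (intro swap_arguments_transpose[of "i - 1" "j - 1"])
      (auto simp: nth_append transpose_def simp del: upt_Suc)
  moreover have "\<mu> (- u # ?vs) = - \<mu> (u # ?vs)" for u
    using module_hom.neg[of scale scale "\<lambda>v. \<mu> (v # ?vs)" u] multilinear[of "u # ?vs" 0] n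
    by (simp add: linear_iff_module_hom)
  ultimately show ?thesis unfolding double_bracket_def vs by simp
qed

lemma double_bracket_transpose_outer:
  assumes "i \<in> {n + 1..n + (n - 1)}" "j \<in> {n + 1..n + (n - 1)}" "i \<noteq> j"
  shows "double_bracket (y \<circ> transpose i j) = - double_bracket y"
proof -
  have us: "map (y \<circ> transpose i j) [1..<n + 1] = map y [1..<n + 1]"
    using assms by (auto simp: transpose_def)
  show ?thesis unfolding double_bracket_def us
    using assms by (intro swap_arguments_transpose[of "i - n" "j - n"])
      (auto simp: nth_Cons' transpose_def simp del: upt_Suc)
qed

lemma sum_signed_compose:
  fixes F :: "(nat \<Rightarrow> nat) \<Rightarrow> 'b"
  assumes \<pi>: "\<pi> permutes S" and "finite S"
  shows "(\<Sum>\<sigma> | \<sigma> permutes S. scale (of_int (sign \<sigma>)) (F (\<sigma> \<circ> \<pi>)))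
       = scale (of_int (sign \<pi>)) (\<Sum>\<sigma> | \<sigma> permutes S. scale (of_int (sign \<sigma>)) (F \<sigma>))"
proof -
  have perm: "permutation \<tau>" if "\<tau> permutes S" for \<tau>
    using permutes_imp_permutation[OF \<open>finite S\<close> that] .
  have "(\<Sum>\<sigma> | \<sigma> permutes S. scale (of_int (sign \<sigma>)) (F \<sigma>))
      = (\<Sum>\<sigma> | \<sigma> permutes S. scale (of_int (sign (\<sigma> \<circ> \<pi>))) (F (\<sigma> \<circ> \<pi>)))"
    by (rule sum_permutations_compose_right[OF \<pi>])
  also have "\<dots> = scale (of_int (sign \<pi>)) (\<Sum>\<sigma> | \<sigma> permutes S. scale (of_int (sign \<sigma>)) (F (\<sigma> \<circ> \<pi>)))"
    using perm[OF \<pi>] by (simp add: perm sign_compose scale_sum_right mult.commute)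
  finally show ?thesis
    by (simp add: sign_def)
qed

text \<open>
  A transposition within a block negates both the sign of \<open>\<sigma>\<close> and the double bracket, so the signed
  summand is constant on the cosets represented by the shuffles, each of size \<open>n! (n-1)!\<close>.
\<close>

lemma antisymmetrised_double_bracket_eq_shuffle_sum:
  "(\<Sum>\<sigma> | \<sigma> permutes {1..n + (n - 1)}. scale (of_int (sign \<sigma>)) (double_bracket (x \<circ> \<sigma>)))
     = scale (of_nat (fact n * fact (n - 1)))
         (\<Sum>\<sigma> \<in> shuffle_perms n (n - 1). scale (of_int (sign \<sigma>)) (double_bracket (x \<circ> \<sigma>)))"
proof -
  let ?f = "\<lambda>\<sigma>. scale (of_int (sign \<sigma>)) (double_bracket (x \<circ> \<sigma>))"
  have perm: "permutation \<sigma>" if "\<sigma> permutes {1..n + (n - 1)}" for \<sigma>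
    using permutes_imp_permutation that by blast
  have step: "?f (\<sigma> \<circ> transpose i j) = ?f \<sigma>"
    if "permutation \<sigma>" "i \<noteq> j" "double_bracket ((x \<circ> \<sigma>) \<circ> transpose i j) = - double_bracket (x \<circ> \<sigma>)"
    for \<sigma> i j
    using that by (simp add: sign_compose permutation_swap_id sign_swap_id o_assoc)
  show ?thesis
  proof (rule sum_permutations_eq_shuffle_sum)
    fix \<sigma> \<alpha> assume \<sigma>: "\<sigma> permutes {1..n + (n - 1)}" and \<alpha>: "\<alpha> permutes {1..n}"
    show "?f (\<sigma> \<circ> \<alpha>) = ?f \<sigma>"
      by (intro invariant_under_permutes_if_invariant_under_transpose[where f = ?f, OF step _ \<alpha> perm[OF \<sigma>]]
            double_bracket_transpose_inner) auto
  next
    fix \<sigma> \<beta> assume \<sigma>: "\<sigma> permutes {1..n + (n - 1)}" and \<beta>: "\<beta> permutes {n + 1..n + (n - 1)}"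
    show "?f (\<sigma> \<circ> \<beta>) = ?f \<sigma>"
      by (intro invariant_under_permutes_if_invariant_under_transpose[where f = ?f, OF step _ \<beta> perm[OF \<sigma>]]
            double_bracket_transpose_outer) auto
  qed
qed

end

section \<open>The Filippov identity under antisymmetrisation\<close>

context n_Lie_algebra
begin

text \<open>
  The sign \<open>e\<close> is that of the exchange of two blocks of length \<open>n - 1\<close>, that is \<open>(-1)^(n-1)\<close>; to
  exclude \<open>n * e = 1\<close> it is enough that \<open>e\<close> is a sign.
\<close>

lemma antisymmetrised_double_bracket_eigenvector:
  assumes "n \<ge> 2"
  obtains e :: int where "e = 1 \<or> e = -1"
    and "(\<Sum>\<sigma> | \<sigma> permutes {1..n + (n - 1)}. scale (of_int (sign \<sigma>)) (double_bracket (x \<circ> \<sigma>)))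
       = scale (of_nat n * of_int e)
           (\<Sum>\<sigma> | \<sigma> permutes {1..n + (n - 1)}. scale (of_int (sign \<sigma>)) (double_bracket (x \<circ> \<sigma>)))"
proof -
  let ?S = "{1..n + (n - 1)}"
  define alt where "alt = (\<lambda>F :: (nat \<Rightarrow> 'b) \<Rightarrow> 'b.
    \<Sum>\<sigma> | \<sigma> permutes ?S. scale (of_int (sign \<sigma>)) (F (x \<circ> \<sigma>)))"
  have alt_compose: "alt (\<lambda>y. F (y \<circ> \<pi>)) = scale (of_int (sign \<pi>)) (alt F)" if "\<pi> permutes ?S" for F \<pi>
    unfolding alt_def using sum_signed_compose[OF that, of "\<lambda>\<sigma>. F (x \<circ> \<sigma>)"] by (simp add: o_assoc)

  define us vs where "us = (\<lambda>y :: nat \<Rightarrow> 'b. map y [1..<n + 1])"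
    and "vs = (\<lambda>y :: nat \<Rightarrow> 'b. map y [n + 1..<2 * n])"
  have len: "length (us y) = n" "length (vs y) = n - 1" for y by (auto simp: us_def vs_def)
  have us_nth: "us y ! k = y (k + 1)" if "k < n" for y k
    using that by (simp add: us_def del: upt_Suc)
  \<comment> \<open>\<open>G i\<close> is the term of the Filippov expansion with the inner bracket at list position \<open>i\<close>,
      which is the argument number \<open>i + 1\<close>.\<close>
  define G where "G = (\<lambda>i y. \<mu> ((us y)[i := \<mu> (us y ! i # vs y)]))"

  have expand: "alt double_bracket = (\<Sum>i<n. alt (G i))"
  proof -
    have "double_bracket y = (\<Sum>i<n. G i y)" for y
      unfolding double_bracket_def G_def using filippov_identity[OF len] by (simp add: us_def vs_def)
    then show ?thesis unfolding alt_def by (simp only: scale_sum_right sum.swap[of _ "{..<n}" "{\<sigma>. \<sigma> permutes ?S}"])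
  qed
  have equal: "alt (G i) = alt (G 0)" if "i < n" for i
  proof (cases "i = 0")
    case False
    let ?t = "transpose 1 (i + 1)"
    \<comment> \<open>After the substitution \<open>y \<circ> ?t\<close> the argument inside the inner bracket is \<open>y 1\<close>, as in \<open>G 0\<close>;
        what remains different is one swap of outer arguments, whose sign cancels that of \<open>?t\<close>.\<close>
    have "?t permutes ?S" using that by (intro permutes_swap_id) auto
    moreover have "G i (y \<circ> ?t) = - G 0 y" for y
    proof -
      have "vs (y \<circ> ?t) = vs y" using that by (auto simp: vs_def transpose_def)
      then show ?thesis unfolding G_def using that False
        by (intro swap_arguments_transpose[of 0 i])
          (auto simp: len us_nth nth_list_update transpose_def)
    qed
    then have "alt (\<lambda>y. G i (y \<circ> ?t)) = - alt (G 0)"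
      by (simp add: alt_def sum_negf)
    ultimately show ?thesis
      using alt_compose[of ?t "G i"] False by (simp add: sign_swap_id)
  qed simp
  have "alt double_bracket = (\<Sum>i<n. alt (G 0))"
    unfolding expand by (intro sum.cong refl equal) simp
  then have J: "alt double_bracket = scale (of_nat n) (alt (G 0))"
    by (simp add: sum_const_eq_scale)

  \<comment> \<open>The exchange of the blocks \<open>{2..n}\<close> and \<open>{n + 1..2n - 1}\<close> turns the double bracket of
      \<open>u\<^sub>1, \<dots>, u\<^sub>n, v\<^sub>1, \<dots>, v\<^bsub>n-1\<^esub>\<close> into \<open>G 0\<close>.\<close>
  define \<pi> where "\<pi> = (\<lambda>k. if k \<in> {2..n} then k + (n - 1)
    else if k \<in> {n + 1..n + (n - 1)} then k - (n - 1) else k)"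
  have "\<pi> (\<pi> k) = k" for k using assms by (auto simp: \<pi>_def)
  then have \<pi>: "\<pi> permutes ?S"
    by (intro bij_imp_permutes bij_betwI[of _ _ _ \<pi>]) (auto simp: \<pi>_def)
  have "double_bracket (y \<circ> \<pi>) = G 0 y" for y
  proof -
    have "us (y \<circ> \<pi>) = us y ! 0 # vs y" using assms
      by (intro nth_equalityI) (auto simp: us_nth us_def vs_def nth_Cons' \<pi>_def add.commute simp del: upt_Suc)
    moreover have "w # vs (y \<circ> \<pi>) = (us y)[0 := w]" for w using assms
      by (intro nth_equalityI) (auto simp: us_def vs_def nth_Cons' \<pi>_def simp del: upt_Suc)
    ultimately show ?thesis by (simp add: double_bracket_def G_def us_def vs_def)
  qed
  then have "alt (G 0) = scale (of_int (sign \<pi>)) (alt double_bracket)"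
    using alt_compose[OF \<pi>, of double_bracket] by simp
  with J have "alt double_bracket = scale (of_nat n * of_int (sign \<pi>)) (alt double_bracket)"
    by simp
  moreover have "sign \<pi> = 1 \<or> sign \<pi> = -1" by (simp add: sign_def)
  ultimately show ?thesis using that unfolding alt_def by blast
qed

end

theorem proposition17:
  fixes scale :: "'k::field_char_0 \<Rightarrow> 'v::ab_group_add \<Rightarrow> 'v"
    and n :: nat
    and \<mu> :: "'v list \<Rightarrow> 'v"
  assumes "n \<ge> 2"
    and "n_Lie_algebra scale n \<mu>"
  shows "sh_n_Lie_algebra scale n \<mu>"
proof -
  interpret n_Lie_algebra scale n \<mu> by fact
  show ?thesis
  proof unfold_locales
    fix x :: "nat \<Rightarrow> 'v"
    let ?term = "\<lambda>\<sigma>. scale (of_int (sign \<sigma>)) (double_bracket (x \<circ> \<sigma>))"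
    let ?J = "\<Sum>\<sigma> | \<sigma> permutes {1..n + (n - 1)}. ?term \<sigma>"
    obtain e :: int where e: "e = 1 \<or> e = -1" and J: "?J = scale (of_nat n * of_int e) ?J"
      using antisymmetrised_double_bracket_eigenvector[OF \<open>n \<ge> 2\<close>] by blast
    have "int n * e \<noteq> 1" using e \<open>n \<ge> 2\<close> by auto
    then have "(of_nat n * of_int e :: 'k) \<noteq> 1"
      by (metis of_int_1 of_int_eq_iff of_int_mult of_int_of_nat_eq)
    moreover have "scale (1 - of_nat n * of_int e) ?J = 0"
      using J by (simp only: scale_left_diff_distrib scale_one) simp
    ultimately have "?J = 0" by (simp only: scale_eq_0_iff) auto
    then have "scale (of_nat (fact n * fact (n - 1))) (\<Sum>\<sigma> \<in> shuffle_perms n (n - 1). ?term \<sigma>) = 0"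
      by (simp only: antisymmetrised_double_bracket_eq_shuffle_sum)
    then have "(\<Sum>\<sigma> \<in> shuffle_perms n (n - 1). ?term \<sigma>) = 0"
      by (simp only: scale_eq_0_iff of_nat_eq_0_iff) simp
    then show "(\<Sum>\<sigma> \<in> shuffle_perms n (n - 1). scale (of_int (sign \<sigma>))
        (\<mu> (\<mu> (map (\<lambda>i. x (\<sigma> i)) [1..<n + 1]) # map (\<lambda>i. x (\<sigma> i)) [n + 1..<2 * n]))) = 0"
      by (simp add: double_bracket_def comp_def)
  qed
qed

end
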